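(* Assume that the following statement holds for every finite nontrivial poset $Q$ (of size $m$, say): the second-largest eigenvalue of $M_Q$ satisfies $\lambda_2(Q)\le \left(1+\frac1m\right)\left(1-\frac2m\right)$, with equality if and only if $Q$ is disconnected, and all eigenvalues of $M_Q$ are non-negative. Then the mixing time of the $P$-random-to-random Markov chain of a finite nontrivial poset $P$ of size $n$ is $O(n^2\log n)$; that is, for every fixed $\varepsilon>0$ there is a constant $C=C(\varepsilon)$ such that for every $n$ and every nontrivial poset $P$ of size $n$, the mixing time of the Markov chain with transition matrix $M_P$ satisfies $t_{\mathrm{mix}}(\varepsilon)\le C\,n^2\log n$.
   Context: Let $P$ be a finite poset of size $n$ with order $\preceq$, whose elements are labeled by $[n]=\{1,\dots,n\}$. A linear extension of $P$ is a permutation $\pi=\pi_1\cdots\pi_n\in S_n$ such that $\pi_i\prec\pi_j$ in $P$ implies $i<j$; $\mathcal L(P)$ is the set of all linear extensions. For $\pi\in\mathcal L(P)$ and $1\le i\le n-1$, let $\pi\cdot\tau_i$ be the linear extension obtained from $\pi$ by interchanging the entries at positions $i$ and $i+1$ if $\pi_i$ and $\pi_{i+1}$ are incomparable in $P$, and $\pi\cdot\tau_i=\pi$ otherwise. Operators act on the right, so in a product the leftmost operator is applied first. For $i,j\in[n]$ set $T_{i,j}=\tau_i\tau_{i+1}\cdots\tau_{j-1}$ if $i\le j$ (the identity if $i=j$) and $T_{i,j}=\tau_{i-1}\tau_{i-2}\cdots\tau_j$ if $i>j$. The $P$-random-to-random shuffle is the Markov chain on $\mathcal L(P)$ with transition matrix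 $$M_P(\pi,\pi')=\frac1{n^2}\left|\{(i,j)\in[n]\times[n] \mid \pi'=\pi\cdot T_{i,j}\}\right|.$$ A poset is trivial if it is a chain (equivalently, it has only one linear extension), and nontrivial otherwise. It is disconnected if its Hasse diagram is a disconnected graph. The matrix $M_P$ is real symmetric and stochastic with largest eigenvalue $1$; $\lambda_2(P)$ denotes its second-largest eigenvalue (counted with multiplicity). For an irreducible aperiodic Markov chain on a finite set $S$ with transition matrix $M$ and stationary distribution $\mu$, put $d(k)=\max_{x\in S}\|M^k(x,\cdot)-\mu\|$, where $\|\sigma-\tau\|=\max_{A\subset S}|\sigma(A)-\tau(A)|$ is the total variation distance. For $\varepsilon>0$ the mixing time is $t_{\mathrm{mix}}(\varepsilon)=\inf\{t\ge0 \mid d(t)\le\varepsilon\}$, with $t$ ranging over integers. *)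

theory Defs
  imports
    "HOL-Combinatorics.Permutations"
    "HOL-Library.Countable_Set"
    "HOL-Library.Extended_Real"
    "HOL-Computational_Algebra.Fundamental_Theorem_Algebra"
    "Jordan_Normal_Form.Char_Poly"
    "Graph_Theory.Digraph_Component"
begin

subsection \<open>Posets on \<open>{1..n}\<close>\<close>

text \<open>
  A poset of size \<open>n\<close> is a relation \<open>P\<close> with \<open>partial_order_on {1..n} P\<close>, where
  \<open>(x, y) \<in> P\<close> means that \<open>x\<close> is less than or equal to \<open>y\<close>.
\<close>

definition poset_less :: "nat rel \<Rightarrow> nat \<Rightarrow> nat \<Rightarrow> bool" where
  "poset_less P x y \<longleftrightarrow> (x, y) \<in> P \<and> x \<noteq> y"

definition incomparable :: "nat rel \<Rightarrow> nat \<Rightarrow> nat \<Rightarrow> bool" where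
  "incomparable P x y \<longleftrightarrow> (x, y) \<notin> P \<and> (y, x) \<notin> P"

definition nontrivial_poset :: "nat \<Rightarrow> nat rel \<Rightarrow> bool" where
  "nontrivial_poset n P \<longleftrightarrow> partial_order_on {1..n} P \<and> \<not> total_on {1..n} P"

definition covers :: "nat rel \<Rightarrow> nat rel" where
  "covers P = {(x, y). poset_less P x y \<and> \<not> (\<exists>z. poset_less P x z \<and> poset_less P z y)}"

definition hasse_diagram :: "nat \<Rightarrow> nat rel \<Rightarrow> nat pair_pre_digraph" where
  "hasse_diagram n P = \<lparr>pverts = {1..n}, parcs = covers P\<rparr>"

text \<open>
  \<open>Digraph_Component.connected\<close> is connectedness of the underlying undirected graph.
\<close>

definition disconnected_poset :: "nat \<Rightarrow> nat rel \<Rightarrow> bool" where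
  "disconnected_poset n P \<longleftrightarrow> \<not> Digraph_Component.connected (with_proj (hasse_diagram n P))"


subsection \<open>Linear extensions and the random-to-random shuffle\<close>

text \<open>
  The word \<open>\<pi>\<^sub>1 \<dots> \<pi>\<^sub>n\<close> is the permutation \<open>\<pi>\<close> of \<open>{1..n}\<close> with \<open>\<pi> i = \<pi>\<^sub>i\<close>
  (and, by the library's convention for \<open>permutes\<close>, \<open>\<pi> i = i\<close> elsewhere).
\<close>

definition linear_extensions :: "nat \<Rightarrow> nat rel \<Rightarrow> (nat \<Rightarrow> nat) set" where
  "linear_extensions n P =
    {\<pi>. \<pi> permutes {1..n} \<and>
        (\<forall>i\<in>{1..n}. \<forall>j\<in>{1..n}. poset_less P (\<pi> i) (\<pi> j) \<longrightarrow> i < j)}"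

definition tau :: "nat rel \<Rightarrow> nat \<Rightarrow> (nat \<Rightarrow> nat) \<Rightarrow> (nat \<Rightarrow> nat)" where
  "tau P i \<pi> =
    (if incomparable P (\<pi> i) (\<pi> (i + 1)) then \<pi>(i := \<pi> (i + 1), i + 1 := \<pi> i) else \<pi>)"

text \<open>
  Operators act on the right, so the leftmost factor is applied first;
  \<open>fold\<close> likewise applies the head of the list first.
\<close>

definition T_op :: "nat rel \<Rightarrow> nat \<Rightarrow> nat \<Rightarrow> (nat \<Rightarrow> nat) \<Rightarrow> (nat \<Rightarrow> nat)" where
  "T_op P i j \<pi> = (if i \<le> j then fold (tau P) [i..<j] \<pi> else fold (tau P) (rev [j..<i]) \<pi>)"

definition r2r_prob :: "nat \<Rightarrow> nat rel \<Rightarrow> (nat \<Rightarrow> nat) \<Rightarrow> (nat \<Rightarrow> nat) \<Rightarrow> real" where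
  "r2r_prob n P \<pi> \<pi>' =
    real (card {(i, j). i \<in> {1..n} \<and> j \<in> {1..n} \<and> \<pi>' = T_op P i j \<pi>}) / (real n)\<^sup>2"

text \<open>
  \<open>from_nat_into S\<close> enumerates a finite set \<open>S\<close> as a bijection from \<open>{..<card S}\<close>;
  it serves to index rows and columns by linear extensions.
\<close>

definition r2r_matrix :: "nat \<Rightarrow> nat rel \<Rightarrow> real mat" where
  "r2r_matrix n P =
    (let L = linear_extensions n P
     in mat (card L) (card L)
          (\<lambda>(a, b). r2r_prob n P (from_nat_into L a) (from_nat_into L b)))"


subsection \<open>Second-largest eigenvalue\<close>

text \<open>
  Eigenvalues are counted with multiplicity as roots of the characteristic polynomial.
  Only real roots are listed; for a symmetric matrix these are all the roots.
  The list is sorted in decreasing order, so index 1 is the second-largest entry.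
\<close>

definition second_largest_eigenvalue :: "real mat \<Rightarrow> real" where
  "second_largest_eigenvalue A = rev (sorted_list_of_multiset (proots (char_poly A))) ! 1"


subsection \<open>Mixing times of finite Markov chains\<close>

text \<open>
  A chain on \<open>{..<N}\<close> is given by its \<open>N \<times> N\<close> transition matrix; distributions are vectors.
\<close>

definition stationary_distribution :: "real mat \<Rightarrow> real vec \<Rightarrow> bool" where
  "stationary_distribution A \<mu> \<longleftrightarrow>
    \<mu> \<in> carrier_vec (dim_row A) \<and>
    (\<forall>i<dim_row A. 0 \<le> \<mu> $ i) \<and> (\<Sum>i<dim_row A. \<mu> $ i) = 1 \<and>
    transpose_mat A *\<^sub>v \<mu> = \<mu>"

text \<open>Well defined for irreducible chains, whose stationary distribution is unique.\<close>

definition the_stationary_distribution :: "real mat \<Rightarrow> real vec" where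
  "the_stationary_distribution A = (THE \<mu>. stationary_distribution A \<mu>)"

definition tv_dist :: "real vec \<Rightarrow> real vec \<Rightarrow> real" where
  "tv_dist \<sigma> \<rho> = Max ((\<lambda>B. \<bar>(\<Sum>i\<in>B. \<sigma> $ i) - (\<Sum>i\<in>B. \<rho> $ i)\<bar>) ` Pow {..<dim_vec \<sigma>})"

definition mixing_dist :: "real mat \<Rightarrow> nat \<Rightarrow> real" where
  "mixing_dist A k =
    Max ((\<lambda>x. tv_dist (row (A ^\<^sub>m k) x) (the_stationary_distribution A)) ` {..<dim_row A})"

text \<open>
  The infimum is taken in \<open>enat\<close>, so it is \<open>\<infinity>\<close> (rather than 0) if the set is empty.
\<close>

definition mixing_time :: "real mat \<Rightarrow> real \<Rightarrow> enat" where
  "mixing_time A \<epsilon> = Inf {enat t | t. mixing_dist A t \<le> \<epsilon>}"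

end

theory Submission
  imports Defs "Jordan_Normal_Form.Schur_Decomposition"
begin

text \<open>
  The shuffle is reversible with respect to the uniform distribution: \<open>T\<^sub>i\<^sub>,\<^sub>j\<close> and
  \<open>T\<^sub>j\<^sub>,\<^sub>i\<close> are inverse to each other, so the transition matrix \<open>M\<close> is symmetric with
  row sums 1. Hence the squared distance of \<open>M\<^sup>k\<close> from its limit, summed over all entries, is a
  trace: with \<open>N\<close> linear extensions and eigenvalues \<open>1, c\<^sub>2, \<dots>, c\<^sub>N\<close>,
  \<open>\<Sum>\<^sub>x \<Sum>\<^sub>y (M\<^sup>k(x, y) - 1/N)\<^sup>2 = tr(M\<^sup>2\<^sup>k) - 1 = \<Sum>\<^sub>i c\<^sub>i\<^sup>2\<^sup>k\<close>, the last sum being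
  over \<open>i \<ge> 2\<close>. If every \<open>c\<^sub>i\<close> with \<open>i \<ge> 2\<close> lies in \<open>[0, q]\<close>, this is at most
  \<open>N q\<^sup>2\<^sup>k\<close>, which bounds the distance from stationarity by \<open>N\<^sup>2 q\<^sup>k\<close>
  (\<open>mixing_dist_le\<close>). Working with traces, for which triangularization suffices, avoids an
  orthonormal eigenbasis.

  The assumed eigenvalue bound gives \<open>q = 1 - 1/n \<le> exp (- 1/n)\<close>, that is, a relaxation time
  of order \<open>n\<close>. The number of states enters only through its logarithm, and
  \<open>N \<le> n! \<le> n\<^sup>n\<close> has logarithm at most \<open>n ln n\<close>. So
  \<open>n (2 n ln n - ln \<epsilon>)\<close> steps suffice (\<open>r2r_mixing_time_le\<close>), which is
  \<open>O(n\<^sup>2 log n)\<close>.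
\<close>

section \<open>Traces of matrix powers\<close>

definition mat_trace :: "'a :: comm_ring_1 mat \<Rightarrow> 'a" where
  "mat_trace A = (\<Sum>i<dim_row A. A $$ (i, i))"

lemma index_mult_mat_sum:
  assumes "A \<in> carrier_mat n n" "B \<in> carrier_mat n n" "i < n" "j < n"
  shows "(A * B) $$ (i, j) = (\<Sum>k<n. A $$ (i, k) * B $$ (k, j))"
  using assms by (auto simp: scalar_prod_def lessThan_atLeast0 intro!: sum.cong)

lemma mat_trace_mult_commute:
  assumes A: "A \<in> carrier_mat n n" and B: "B \<in> carrier_mat n n"
  shows "mat_trace (A * B) = mat_trace (B * A)"
proof -
  have "mat_trace (A * B) = (\<Sum>i<n. \<Sum>k<n. A $$ (i, k) * B $$ (k, i))"
    using A B by (simp add: mat_trace_def index_mult_mat_sum[OF A B] del: index_mult_mat(1))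
  also have "\<dots> = (\<Sum>k<n. \<Sum>i<n. B $$ (k, i) * A $$ (i, k))"
    by (subst sum.swap) (simp add: mult.commute)
  also have "\<dots> = mat_trace (B * A)"
    using A B by (simp add: mat_trace_def index_mult_mat_sum[OF B A] del: index_mult_mat(1))
  finally show ?thesis .
qed

lemma mat_trace_conjugate:
  assumes "P \<in> carrier_mat n n" "B \<in> carrier_mat n n" "Q \<in> carrier_mat n n" "Q * P = 1\<^sub>m n"
  shows "mat_trace (P * B * Q) = mat_trace B"
proof -
  have "mat_trace (P * B * Q) = mat_trace (Q * (P * B))"
    using assms by (intro mat_trace_mult_commute[of _ n]) auto
  also have "Q * (P * B) = B"
    using assms by (metis assoc_mult_mat left_mult_one_mat)
  finally show ?thesis .
qed

text \<open>
  In the sum for entry \<open>(i, j)\<close> with \<open>j \<le> i\<close>, the summand of index \<open>k\<close> vanishes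
  when \<open>k < i\<close> because of \<open>A\<close> and when \<open>j < k\<close> because of \<open>B\<close>; only
  \<open>k = i = j\<close> escapes.
\<close>

lemma upper_triangular_mult_entry:
  assumes A: "A \<in> carrier_mat n n" "upper_triangular A"
    and B: "B \<in> carrier_mat n n" "upper_triangular B"
    and ij: "j \<le> i" "i < n"
  shows "(A * B) $$ (i, j) = (if i = j then A $$ (i, i) * B $$ (i, i) else 0)"
proof -
  have "A $$ (i, k) * B $$ (k, j) = (if k = i \<and> i = j then A $$ (i, i) * B $$ (i, i) else 0)"
    if "k < n" for k
  proof -
    consider "k < i" | "j < k" | "k = i" "i = j" using ij by linarith
    then show ?thesis
      using that ij A(1) B(1) upper_triangularD[OF A(2), of k i] upper_triangularD[OF B(2), of j k]
      by cases auto
  qed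
  then have "(A * B) $$ (i, j)
      = (\<Sum>k<n. if k = i \<and> i = j then A $$ (i, i) * B $$ (i, i) else 0)"
    using ij index_mult_mat_sum[OF A(1) B(1)] by simp
  also have "\<dots> = (if i = j then A $$ (i, i) * B $$ (i, i) else 0)"
    using ij by (cases "i = j") (auto simp: sum.delta)
  finally show ?thesis .
qed

lemma upper_triangular_pow_mat:
  assumes A: "A \<in> carrier_mat n n" "upper_triangular A"
  shows "upper_triangular (A ^\<^sub>m k) \<and> (\<forall>i<n. (A ^\<^sub>m k) $$ (i, i) = (A $$ (i, i)) ^ k)"
proof (induction k)
  case 0
  then show ?case using A by auto
next
  case (Suc k)
  have c: "A ^\<^sub>m k \<in> carrier_mat n n" using A by (simp add: pow_carrier_mat)
  note e = upper_triangular_mult_entry[OF c conjunct1[OF Suc] A]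
  show ?case
    using Suc A e c by (auto simp del: index_mult_mat(1) simp add: power_commutes intro!: upper_triangularI)
qed

text \<open>
  A Schur decomposition makes \<open>A\<close> similar to a triangular matrix with diagonal \<open>es\<close>; taking
  powers commutes with the similarity and acts entrywise on the diagonal.
\<close>

lemma mat_trace_pow_mat:
  fixes A :: "'a :: conjugatable_ordered_field mat"
  assumes A: "A \<in> carrier_mat n n" and es: "char_poly A = (\<Prod>a\<leftarrow>es. [:- a, 1:])"
  shows "mat_trace (A ^\<^sub>m k) = (\<Sum>a\<leftarrow>es. a ^ k)"
proof -
  obtain B P Q where s: "schur_decomposition A es = (B, P, Q)"
    by (cases "schur_decomposition A es") auto
  from schur_decomposition[OF A es s]
  have wit: "similar_mat_wit A B P Q" and ut: "upper_triangular B" and d: "diag_mat B = es"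
    by auto
  note w = similar_mat_witD2[OF A wit]
  have Bk: "B ^\<^sub>m k \<in> carrier_mat n n" using w by (simp add: pow_carrier_mat)
  have "mat_trace (A ^\<^sub>m k) = mat_trace (P * B ^\<^sub>m k * Q)"
    by (simp add: similar_mat_wit_pow_id[OF wit])
  also have "\<dots> = mat_trace (B ^\<^sub>m k)"
    by (rule mat_trace_conjugate) (use w Bk in auto)
  also have "\<dots> = (\<Sum>i<n. (B $$ (i, i)) ^ k)"
    using upper_triangular_pow_mat[OF w(5) ut] w(5) by (simp add: mat_trace_def)
  also have "\<dots> = (\<Sum>a\<leftarrow>diag_mat B. a ^ k)"
    using w(5) by (simp add: diag_mat_def sum_list_distinct_conv_sum_set o_def lessThan_atLeast0)
  finally show ?thesis by (simp add: d)
qed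

lemma pow_mat_add:
  assumes "A \<in> carrier_mat n n"
  shows "A ^\<^sub>m (k + l) = A ^\<^sub>m k * A ^\<^sub>m l"
proof (induction l)
  case 0
  then show ?case using assms by (simp add: pow_carrier_mat)
next
  case (Suc l)
  then show ?case
    using assms assoc_mult_mat[of "A ^\<^sub>m k" n n "A ^\<^sub>m l" n A n] by (simp add: pow_carrier_mat)
qed

section \<open>Real symmetric matrices\<close>

text \<open>
  For a complex eigenvector \<open>v\<close>, the number \<open>h = v\<^sup>* A v\<close> equals
  \<open>c * s\<close> with \<open>s\<close> the squared length of \<open>v\<close>, and symmetry of \<open>A\<close> makes
  \<open>h\<close> its own conjugate.
\<close>

lemma eigenvalue_symmetric_real:
  fixes A :: "real mat"
  assumes A: "A \<in> carrier_mat n n"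
    and sym: "\<And>x y. x < n \<Longrightarrow> y < n \<Longrightarrow> A $$ (x, y) = A $$ (y, x)"
    and ev: "eigenvalue (map_mat complex_of_real A) c"
  shows "c \<in> \<real>"
proof -
  let ?A = "map_mat complex_of_real A"
  obtain v where v: "v \<in> carrier_vec n" "v \<noteq> 0\<^sub>v n" and Av: "?A *\<^sub>v v = c \<cdot>\<^sub>v v"
    using ev A unfolding eigenvalue_def eigenvector_def by auto
  have comp: "(\<Sum>y<n. of_real (A $$ (x, y)) * v $ y) = c * v $ x" if "x < n" for x
    using arg_cong[OF Av, of "\<lambda>w. w $ x"] that v A
    by (simp add: scalar_prod_def lessThan_atLeast0)
  define s where "s = (\<Sum>x<n. (cmod (v $ x))\<^sup>2)"
  define h where "h = (\<Sum>x<n. \<Sum>y<n. cnj (v $ x) * (of_real (A $$ (x, y)) * v $ y))"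
  have "h = (\<Sum>x<n. cnj (v $ x) * (c * v $ x))"
    unfolding h_def by (simp add: comp flip: sum_distrib_left)
  also have "\<dots> = c * of_real s"
    unfolding s_def by (simp add: sum_distrib_left complex_norm_square mult_ac del: of_real_power)
  finally have h: "h = c * of_real s" .
  have "cnj h = (\<Sum>x<n. \<Sum>y<n. v $ x * (of_real (A $$ (x, y)) * cnj (v $ y)))"
    by (simp add: h_def)
  also have "\<dots> = (\<Sum>y<n. \<Sum>x<n. v $ x * (of_real (A $$ (x, y)) * cnj (v $ y)))"
    by (rule sum.swap)
  also have "\<dots> = h"
    unfolding h_def by (intro sum.cong refl) (use sym in auto)
  finally have "cnj c * of_real s = c * of_real s" using h by simp
  moreover have "s \<noteq> 0"
  proof
    assume "s = 0"
    then have "\<forall>x<n. v $ x = 0" unfolding s_def by (simp add: sum_nonneg_eq_0_iff)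
    then show False using v by (metis eq_vecI carrier_vecD index_zero_vec)
  qed
  ultimately have "cnj c = c" by simp
  then show ?thesis by (simp add: Reals_cnj_iff)
qed

lemma proots_prod_linear: "proots (\<Prod>a\<leftarrow>es. [:- a, 1:]) = mset (es :: 'a :: idom list)"
proof (induction es)
  case (Cons a es)
  have "(\<Prod>a\<leftarrow>es. [:- a, 1:]) \<noteq> 0" by (auto simp: prod_list_zero_iff)
  with Cons show ?case by (simp add: proots_mult del: mult_pCons_left)
qed simp

lemma char_poly_symmetric_splits:
  fixes A :: "real mat"
  assumes A: "A \<in> carrier_mat n n"
    and sym: "\<And>x y. x < n \<Longrightarrow> y < n \<Longrightarrow> A $$ (x, y) = A $$ (y, x)"
  obtains es where "char_poly A = (\<Prod>a\<leftarrow>es. [:- a, 1:])" "length es = n"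
proof -
  let ?A = "map_mat complex_of_real A"
  have cA: "?A \<in> carrier_mat n n" using A by simp
  obtain cs where cs: "char_poly ?A = (\<Prod>a\<leftarrow>cs. [:- a, 1:])" "length cs = n"
    using char_poly_factorized[OF cA] by blast
  have real: "c \<in> \<real>" if "c \<in> set cs" for c
  proof (rule eigenvalue_symmetric_real[OF A sym])
    show "eigenvalue ?A c"
      using that unfolding eigenvalue_root_char_poly[OF cA] cs(1)
      by (auto simp: poly_prod_list prod_list_zero_iff)
  qed auto
  have "map_poly complex_of_real (char_poly A) = char_poly ?A"
    by (rule of_real_hom.char_poly_hom[OF A, symmetric])
  also have "\<dots> = (\<Prod>a\<leftarrow>map complex_of_real (map Re cs). [:- a, 1:])"
    unfolding cs(1) by (intro arg_cong[of _ _ prod_list]) (use real in \<open>auto simp: o_def\<close>)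
  also have "\<dots> = map_poly complex_of_real (\<Prod>a\<leftarrow>map Re cs. [:- a, 1:])"
  proof -
    interpret map_of_real: map_poly_comm_ring_hom complex_of_real ..
    show ?thesis by (simp add: map_of_real.hom_prod_list o_def)
  qed
  finally have "char_poly A = (\<Prod>a\<leftarrow>map Re cs. [:- a, 1:])"
    by (simp add: poly_eq_iff coeff_map_poly)
  then show thesis using that[of "map Re cs"] cs(2) by simp
qed

section \<open>Mixing of symmetric chains with a spectral gap\<close>

text \<open>
  The value \<open>1\<close> is an eigenvalue because the row sums are 1. Since \<open>q < 1\<close>, the bound
  on the second-largest eigenvalue says that all eigenvalues but one copy of \<open>1\<close> are at most
  \<open>q\<close>.
\<close>

locale symmetric_gap =
  fixes A :: "real mat" and N :: nat and q :: real
  assumes carrier: "A \<in> carrier_mat N N"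
    and nonempty: "0 < N"
    and symmetric: "x < N \<Longrightarrow> y < N \<Longrightarrow> A $$ (x, y) = A $$ (y, x)"
    and row_sum: "x < N \<Longrightarrow> (\<Sum>y<N. A $$ (x, y)) = 1"
    and eigenvalue_nonneg: "eigenvalue A c \<Longrightarrow> 0 \<le> c"
    and second_le: "second_largest_eigenvalue A \<le> q"
    and q_nonneg: "0 \<le> q" and q_less_1: "q < 1"
begin

lemma pow_carrier: "A ^\<^sub>m k \<in> carrier_mat N N"
  using carrier by (simp add: pow_carrier_mat)

lemma pow_Suc_entry:
  "x < N \<Longrightarrow> y < N \<Longrightarrow> (A ^\<^sub>m Suc k) $$ (x, y) = (\<Sum>z<N. (A ^\<^sub>m k) $$ (x, z) * A $$ (z, y))"
  using index_mult_mat_sum[OF pow_carrier carrier] by simp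

lemma pow_row_sum: "x < N \<Longrightarrow> (\<Sum>y<N. (A ^\<^sub>m k) $$ (x, y)) = 1"
proof (induction k)
  case 0
  then show ?case using carrier by (simp add: sum.delta)
next
  case (Suc k)
  have "(\<Sum>y<N. (A ^\<^sub>m Suc k) $$ (x, y)) = (\<Sum>y<N. \<Sum>z<N. (A ^\<^sub>m k) $$ (x, z) * A $$ (z, y))"
    using Suc.prems by (simp add: pow_Suc_entry del: pow_mat.simps)
  also have "\<dots> = (\<Sum>z<N. (A ^\<^sub>m k) $$ (x, z) * (\<Sum>y<N. A $$ (z, y)))"
    by (subst sum.swap) (simp add: sum_distrib_left)
  finally show ?case using Suc by (simp add: row_sum)
qed

lemma pow_symmetric: "x < N \<Longrightarrow> y < N \<Longrightarrow> (A ^\<^sub>m k) $$ (x, y) = (A ^\<^sub>m k) $$ (y, x)"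
proof (induction k arbitrary: x y)
  case 0
  then show ?case using carrier by simp
next
  case (Suc k)
  have comm: "A ^\<^sub>m Suc k = A * A ^\<^sub>m k"
    using pow_mat_add[OF carrier, of 1 k] carrier by simp
  have "(A ^\<^sub>m Suc k) $$ (x, y) = (\<Sum>z<N. A $$ (y, z) * (A ^\<^sub>m k) $$ (z, x))"
    using Suc by (auto simp: pow_Suc_entry symmetric[of _ y] mult.commute
        simp del: pow_mat.simps intro!: sum.cong)
  also have "\<dots> = (A ^\<^sub>m Suc k) $$ (y, x)"
    unfolding comm using index_mult_mat_sum[OF carrier pow_carrier] Suc.prems by simp
  finally show ?case .
qed

lemma eigenvalue_one: "eigenvalue A 1"
proof -
  have "A *\<^sub>v vec N (\<lambda>_. 1) = 1 \<cdot>\<^sub>v vec N (\<lambda>_. 1)"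
    using carrier row_sum by (auto simp: scalar_prod_def lessThan_atLeast0)
  moreover have "vec N (\<lambda>_. 1 :: real) \<noteq> 0\<^sub>v N"
    using nonempty by (auto dest!: arg_cong[of _ _ "\<lambda>w. w $ 0"])
  ultimately show ?thesis
    using carrier unfolding eigenvalue_def eigenvector_def by (intro exI[of _ "vec N (\<lambda>_. 1)"]) auto
qed

lemma mat_trace_pow_le: "mat_trace (A ^\<^sub>m (2 * k)) \<le> 1 + real N * (q ^ k)\<^sup>2"
proof -
  obtain es where es: "char_poly A = (\<Prod>a\<leftarrow>es. [:- a, 1:])" "length es = N"
    using char_poly_symmetric_splits[OF carrier] symmetric by blast
  have proots: "proots (char_poly A) = mset es"
    unfolding es(1) by (rule proots_prod_linear)
  define s where "s = rev (sort es)"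
  have second: "s ! 1 \<le> q"
    using second_le by (simp add: second_largest_eigenvalue_def proots s_def)
  have mset: "mset s = mset es" by (simp add: s_def)
  have len: "length s = N" using es(2) by (simp add: s_def)
  have ev: "eigenvalue A c \<longleftrightarrow> c \<in> set s" for c
    unfolding eigenvalue_root_char_poly[OF carrier] es(1)
    by (auto simp: s_def poly_prod_list prod_list_zero_iff)
  have le_q: "s ! i \<le> q" if "0 < i" "i < length s" for i
  proof -
    have "sorted_wrt (\<ge>) s" unfolding s_def by (simp add: sorted_wrt_rev)
    then have "s ! i \<le> s ! 1"
      using that by (cases "i = 1") (auto simp: sorted_wrt_iff_nth_less)
    with second show ?thesis by simp
  qed
  obtain i where i: "i < length s" "s ! i = 1"
    using eigenvalue_one ev by (metis in_set_conv_nth)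
  \<comment> \<open>A later index would force \<open>1 \<le> q\<close>.\<close>
  have "i = 0" using le_q[of i] i q_less_1 by force
  with i obtain s' where s': "s = 1 # s'" by (cases s) auto
  have bound: "0 \<le> c \<and> c \<le> q" if c: "c \<in> set s'" for c
  proof -
    obtain j where "j < length s'" "c = s' ! j" using c by (metis in_set_conv_nth)
    then have "c \<le> q" using le_q[of "Suc j"] s' by simp
    moreover have "0 \<le> c" using c s' ev eigenvalue_nonneg by simp
    ultimately show ?thesis by simp
  qed
  have "mat_trace (A ^\<^sub>m (2 * k)) = (\<Sum>c\<leftarrow>es. c ^ (2 * k))"
    by (rule mat_trace_pow_mat[OF carrier es(1)])
  also have "\<dots> = (\<Sum>c\<leftarrow>s. c ^ (2 * k))"
    using mset by (metis mset_map sum_mset_sum_list)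
  also have "\<dots> = 1 + (\<Sum>c\<leftarrow>s'. c ^ (2 * k))" by (simp add: s')
  also have "(\<Sum>c\<leftarrow>s'. c ^ (2 * k)) \<le> (\<Sum>c\<leftarrow>s'. q ^ (2 * k))"
    by (intro sum_list_mono power_mono) (use bound in auto)
  also have "\<dots> = real (length s') * q ^ (2 * k)" by (simp add: sum_list_triv)
  also have "\<dots> \<le> real N * q ^ (2 * k)"
    using len s' q_nonneg by (intro mult_right_mono) auto
  finally show ?thesis by (simp add: power_mult[of q k 2, symmetric] mult.commute)
qed

text \<open>
  By symmetry of \<open>A ^\<^sub>m k\<close> the sum of its squared entries is the trace of
  \<open>A ^\<^sub>m (2 * k)\<close>; since each row sums to 1, subtracting \<open>1 / N\<close> from every entry
  lowers this sum by exactly 1. A single entry is estimated by the whole sum, with a spare factor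
  \<open>N\<close> under the square root to keep the bound free of roots.
\<close>

lemma pow_near_uniform:
  assumes xy: "x < N" "y < N"
  shows "\<bar>(A ^\<^sub>m k) $$ (x, y) - 1 / real N\<bar> \<le> real N * q ^ k"
proof -
  let ?a = "\<lambda>x y. (A ^\<^sub>m k) $$ (x, y)"
  have tr: "mat_trace (A ^\<^sub>m (2 * k)) = (\<Sum>x<N. \<Sum>y<N. (?a x y)\<^sup>2)"
  proof -
    have "A ^\<^sub>m (2 * k) = A ^\<^sub>m k * A ^\<^sub>m k"
      using pow_mat_add[OF carrier, of k k] by (simp add: mult_2)
    then show ?thesis
      using pow_carrier[of k] carrier index_mult_mat_sum[OF pow_carrier pow_carrier, of _ _ k k]
      by (auto simp: mat_trace_def power2_eq_square pow_symmetric[of _ _ k]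
          simp del: index_mult_mat(1) intro!: sum.cong)
  qed
  have row: "(\<Sum>y<N. (?a x y - 1 / real N)\<^sup>2) = (\<Sum>y<N. (?a x y)\<^sup>2) - 1 / real N" if "x < N" for x
  proof -
    have "(\<Sum>y<N. (?a x y - 1 / real N)\<^sup>2)
        = (\<Sum>y<N. (?a x y)\<^sup>2) - 2 / real N * (\<Sum>y<N. ?a x y) + real N * (1 / real N)\<^sup>2"
      by (simp add: power2_diff sum.distrib sum_subtractf sum_distrib_left algebra_simps)
    then show ?thesis
      using pow_row_sum[OF that] nonempty by (simp add: power2_eq_square field_simps)
  qed
  have "(?a x y - 1 / real N)\<^sup>2 \<le> (\<Sum>y<N. (?a x y - 1 / real N)\<^sup>2)"
    using xy by (intro member_le_sum) auto
  also have "\<dots> \<le> (\<Sum>x<N. \<Sum>y<N. (?a x y - 1 / real N)\<^sup>2)"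
    using xy by (intro member_le_sum[of x _ "\<lambda>x. \<Sum>y<N. (?a x y - 1 / real N)\<^sup>2"])
      (auto intro!: sum_nonneg)
  also have "\<dots> = mat_trace (A ^\<^sub>m (2 * k)) - 1"
    using nonempty by (simp add: row tr sum_subtractf)
  also have "\<dots> \<le> real N * (q ^ k)\<^sup>2" using mat_trace_pow_le[of k] by simp
  also have "\<dots> \<le> (real N)\<^sup>2 * (q ^ k)\<^sup>2"
    using nonempty by (intro mult_right_mono) (auto simp: power2_eq_square)
  finally have "(?a x y - 1 / real N)\<^sup>2 \<le> (real N * q ^ k)\<^sup>2" by (simp add: power_mult_distrib)
  then show ?thesis
    using q_nonneg by (metis abs_le_square_iff abs_of_nonneg mult_nonneg_nonneg of_nat_0_le_iff zero_le_power)
qed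

text \<open>
  A stationary \<open>w\<close> is fixed by every power of \<open>A\<close>, and these converge to the matrix with
  all entries \<open>1 / N\<close>, which sends \<open>w\<close> to the uniform distribution. The spectral gap thus
  replaces an argument from irreducibility.
\<close>

lemma stationary_distribution_unique:
  assumes w: "stationary_distribution A w"
  shows "w = vec N (\<lambda>_. 1 / real N)"
proof -
  have w': "w \<in> carrier_vec N" "\<And>i. i < N \<Longrightarrow> 0 \<le> w $ i" "(\<Sum>i<N. w $ i) = 1"
    "transpose_mat A *\<^sub>v w = w"
    using w carrier by (auto simp: stationary_distribution_def)
  have step: "(\<Sum>x<N. w $ x * A $$ (x, y)) = w $ y" if "y < N" for y
    using arg_cong[OF w'(4), of "\<lambda>u. u $ y"] that w'(1) carrier
    by (simp add: scalar_prod_def lessThan_atLeast0 mult.commute)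
  have pow: "(\<Sum>x<N. w $ x * (A ^\<^sub>m k) $$ (x, y)) = w $ y" if "y < N" for k y
    using that
  proof (induction k arbitrary: y)
    case 0
    then show ?case using carrier by (simp add: if_distrib cong: if_cong)
  next
    case (Suc k)
    have "(\<Sum>x<N. w $ x * (A ^\<^sub>m Suc k) $$ (x, y))
        = (\<Sum>x<N. \<Sum>z<N. w $ x * (A ^\<^sub>m k) $$ (x, z) * A $$ (z, y))"
      using Suc.prems by (simp add: pow_Suc_entry sum_distrib_left mult.assoc del: pow_mat.simps)
    also have "\<dots> = (\<Sum>z<N. (\<Sum>x<N. w $ x * (A ^\<^sub>m k) $$ (x, z)) * A $$ (z, y))"
      by (subst sum.swap) (simp add: sum_distrib_right)
    also have "\<dots> = w $ y" using Suc by (simp add: step)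
    finally show ?case .
  qed
  have "w $ y = 1 / real N" if y: "y < N" for y
  proof -
    have le: "\<bar>w $ y - 1 / real N\<bar> \<le> real N * q ^ k" for k
    proof -
      have "w $ y - 1 / real N = (\<Sum>x<N. w $ x * ((A ^\<^sub>m k) $$ (x, y) - 1 / real N))"
        using pow[OF y, of k] w'(3) by (simp add: right_diff_distrib sum_subtractf flip: sum_divide_distrib)
      also have "\<bar>\<dots>\<bar> \<le> (\<Sum>x<N. w $ x * (real N * q ^ k))"
        using w'(2) pow_near_uniform y
        by (intro order.trans[OF sum_abs] sum_mono) (auto simp: abs_mult intro!: mult_left_mono)
      also have "\<dots> = real N * q ^ k" using w'(3) by (simp flip: sum_distrib_right)
      finally show ?thesis .
    qed
    have "(\<lambda>k. real N * q ^ k) \<longlonglongrightarrow> real N * 0"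
      using q_nonneg q_less_1 by (intro tendsto_mult_left LIMSEQ_power_zero) auto
    then have "\<bar>w $ y - 1 / real N\<bar> \<le> real N * 0"
      by (rule LIMSEQ_le_const) (use le in auto)
    then show ?thesis by simp
  qed
  then show ?thesis using w'(1) by (intro eq_vecI) auto
qed

lemma the_stationary_distribution_uniform:
  "the_stationary_distribution A = vec N (\<lambda>_. 1 / real N)"
  unfolding the_stationary_distribution_def
proof (rule the_equality)
  have "(\<Sum>y<N. A $$ (y, x)) = 1" if "x < N" for x
  proof -
    have "(\<Sum>y<N. A $$ (y, x)) = (\<Sum>y<N. A $$ (x, y))"
      by (intro sum.cong refl symmetric) (use that in auto)
    then show ?thesis using row_sum[OF that] by simp
  qed
  then show "stationary_distribution A (vec N (\<lambda>_. 1 / real N))"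
    using carrier nonempty
    by (auto simp: stationary_distribution_def scalar_prod_def lessThan_atLeast0 simp flip: sum_divide_distrib)
qed (rule stationary_distribution_unique)

lemma mixing_dist_le: "mixing_dist A k \<le> (real N)\<^sup>2 * q ^ k"
proof -
  have tv: "tv_dist (row (A ^\<^sub>m k) x) (vec N (\<lambda>_. 1 / real N)) \<le> (real N)\<^sup>2 * q ^ k"
    if x: "x < N" for x
  proof -
    have "\<bar>(\<Sum>i\<in>B. row (A ^\<^sub>m k) x $ i) - (\<Sum>i\<in>B. vec N (\<lambda>_. 1 / real N) $ i)\<bar>
        \<le> (real N)\<^sup>2 * q ^ k" if B: "B \<subseteq> {..<N}" for B
    proof -
      have "\<bar>(\<Sum>i\<in>B. row (A ^\<^sub>m k) x $ i) - (\<Sum>i\<in>B. vec N (\<lambda>_. 1 / real N) $ i)\<bar>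
          = \<bar>\<Sum>i\<in>B. (A ^\<^sub>m k) $$ (x, i) - 1 / real N\<bar>"
        using B x carrier
        by (subst sum_subtractf[symmetric])
          (intro arg_cong[of _ _ abs] sum.cong, auto simp: subset_iff)
      also have "\<dots> \<le> (\<Sum>i\<in>B. real N * q ^ k)"
        using B x by (intro order.trans[OF sum_abs] sum_mono pow_near_uniform) auto
      also have "\<dots> \<le> (\<Sum>i<N. real N * q ^ k)"
        using B q_nonneg by (intro sum_mono2) auto
      finally show ?thesis by (simp add: power2_eq_square mult.assoc)
    qed
    then show ?thesis
      using pow_carrier[of k] unfolding tv_dist_def by (subst Max_le_iff) auto
  qed
  then show ?thesis
    using carrier nonempty
    by (auto simp: mixing_dist_def the_stationary_distribution_uniform lessThan_empty_iff)
qed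

end

section \<open>Linear extensions and the shuffle matrix\<close>

lemma tau_tau: "tau P i (tau P i \<pi>) = \<pi>"
  by (auto simp: tau_def incomparable_def fun_eq_iff)

lemma fold_tau_rev: "fold (tau P) (rev is) (fold (tau P) is \<pi>) = \<pi>"
  by (induction "is" arbitrary: \<pi>) (auto simp: tau_tau)

lemma T_op_inverse: "T_op P j i (T_op P i j \<pi>) = \<pi>"
  using fold_tau_rev[of P "[i..<j]" \<pi>] fold_tau_rev[of P "rev [j..<i]" \<pi>]
  by (auto simp: T_op_def)

text \<open>
  Exchanging neighbours changes the relative order of no other pair of entries, and \<open>tau\<close>
  exchanges them only if they are incomparable.
\<close>

lemma tau_linear_extension:
  assumes "\<pi> \<in> linear_extensions n P" and i: "1 \<le> i" "i < n"
  shows "tau P i \<pi> \<in> linear_extensions n P"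
proof (cases "incomparable P (\<pi> i) (\<pi> (i + 1))")
  case True
  let ?\<sigma> = "Transposition.transpose i (i + 1)"
  have \<pi>: "\<pi> permutes {1..n}"
    and ord: "\<And>a b. a \<in> {1..n} \<Longrightarrow> b \<in> {1..n} \<Longrightarrow> poset_less P (\<pi> a) (\<pi> b) \<Longrightarrow> a < b"
    using assms by (auto simp: linear_extensions_def)
  have eq: "tau P i \<pi> = \<pi> \<circ> ?\<sigma>"
    using True by (auto simp: tau_def Transposition.transpose_def fun_eq_iff)
  have \<sigma>: "?\<sigma> permutes {1..n}" using i by (intro permutes_swap_id) auto
  have "a < b" if ab: "a \<in> {1..n}" "b \<in> {1..n}" "poset_less P (\<pi> (?\<sigma> a)) (\<pi> (?\<sigma> b))" for a b
  proof -
    have less: "?\<sigma> a < ?\<sigma> b"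
      using ab by (intro ord) (simp_all only: permutes_in_image[OF \<sigma>])
    have "\<not> (a = i + 1 \<and> b = i)"
      using ab(3) True by (auto simp: poset_less_def incomparable_def)
    then show ?thesis
      using less by (auto simp: Transposition.transpose_def split: if_splits)
  qed
  then show ?thesis
    using permutes_compose[OF \<sigma> \<pi>] by (auto simp: linear_extensions_def eq)
next
  case False
  then show ?thesis using assms by (simp add: tau_def)
qed

lemma T_op_linear_extension:
  assumes "\<pi> \<in> linear_extensions n P" "i \<in> {1..n}" "j \<in> {1..n}"
  shows "T_op P i j \<pi> \<in> linear_extensions n P"
proof -
  have "fold (tau P) is \<pi> \<in> linear_extensions n P" if "set is \<subseteq> {1..<n}" for "is"
    using assms(1) that
    by (induction "is" arbitrary: \<pi>) (auto simp: tau_linear_extension)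
  from this[of "[i..<j]"] this[of "rev [j..<i]"] show ?thesis
    using assms(2,3) by (auto simp: T_op_def)
qed

text \<open>
  Swapping \<open>i\<close> and \<open>j\<close> matches the pairs leading from \<open>\<pi>\<close> to \<open>\<pi>'\<close> with
  those leading back.
\<close>

lemma r2r_prob_symmetric: "r2r_prob n P \<pi> \<pi>' = r2r_prob n P \<pi>' \<pi>"
proof -
  have "bij_betw prod.swap {(i, j). i \<in> {1..n} \<and> j \<in> {1..n} \<and> \<pi>' = T_op P i j \<pi>}
      {(i, j). i \<in> {1..n} \<and> j \<in> {1..n} \<and> \<pi> = T_op P i j \<pi>'}"
    by (rule bij_betw_byWitness[where f' = prod.swap]) (auto simp: T_op_inverse)
  then show ?thesis by (simp add: r2r_prob_def bij_betw_same_card)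
qed

lemma finite_linear_extensions: "finite (linear_extensions n P)"
  by (rule finite_subset[of _ "{\<pi>. \<pi> permutes {1..n}}"])
    (auto simp: linear_extensions_def finite_permutations)

lemma card_linear_extensions_le: "card (linear_extensions n P) \<le> n ^ n"
proof -
  have "card (linear_extensions n P) \<le> card {\<pi>. \<pi> permutes {1..n}}"
    by (intro card_mono) (auto simp: linear_extensions_def finite_permutations)
  also have "\<dots> = fact n" by (rule card_permutations) auto
  also have "\<dots> \<le> n ^ n" using fact_le_power[of n, where 'a = nat] by simp
  finally show ?thesis .
qed

lemma sum_r2r_prob:
  assumes "\<pi> \<in> linear_extensions n P" "0 < n"
  shows "(\<Sum>\<pi>'\<in>linear_extensions n P. r2r_prob n P \<pi> \<pi>') = 1"
proof -
  let ?I = "{1..n} \<times> {1..n}" and ?T = "\<lambda>(i, j). T_op P i j \<pi>"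
  have "(\<Sum>\<pi>'\<in>linear_extensions n P. card {p \<in> ?I. ?T p = \<pi>'}) = card ?I"
    using sum.group[of ?I "linear_extensions n P" ?T "\<lambda>_. 1 :: nat"]
      finite_linear_extensions T_op_linear_extension[OF assms(1)]
    by (simp add: image_subset_iff)
  moreover have "{(i, j). i \<in> {1..n} \<and> j \<in> {1..n} \<and> \<pi>' = T_op P i j \<pi>} = {p \<in> ?I. ?T p = \<pi>'}" for \<pi>'
    by auto
  ultimately show ?thesis
    using assms(2)
    by (simp add: r2r_prob_def power2_eq_square flip: sum_divide_distrib of_nat_sum of_nat_mult)
qed

text \<open>
  The number of elements below \<open>x\<close> is strictly monotone in \<open>x\<close>, so listing the elements
  by increasing size of their down-sets yields a linear extension.
\<close>

lemma linear_extensions_nonempty: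
  assumes P: "partial_order_on {1..n} P"
  shows "linear_extensions n P \<noteq> {}"
proof -
  have sub: "P \<subseteq> {1..n} \<times> {1..n}" and refl: "refl_on {1..n} P" and "trans P" "antisym P"
    using P by (auto simp: partial_order_on_def preorder_on_def)
  define h where "h x = card {y. (y, x) \<in> P}" for x
  have h: "h x < h y" if "poset_less P x y" for x y
    unfolding h_def
  proof (rule psubset_card_mono)
    show "finite {z. (z, y) \<in> P}" by (rule finite_subset[of _ "{1..n}"]) (use sub in auto)
    have "(x, y) \<in> P" "x \<noteq> y" using that by (auto simp: poset_less_def)
    moreover have "(y, y) \<in> P" using \<open>(x, y) \<in> P\<close> sub refl by (auto dest: refl_onD)
    ultimately show "{z. (z, x) \<in> P} \<subset> {z. (z, y) \<in> P}"
      using \<open>trans P\<close> \<open>antisym P\<close> by (auto dest: transD antisymD)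
  qed
  define xs where "xs = sort_key h [1..<Suc n]"
  have xs: "distinct xs" "set xs = {1..n}" "length xs = n" "sorted (map h xs)"
    by (auto simp: xs_def)
  define \<pi> where "\<pi> i = (if i \<in> {1..n} then xs ! (i - 1) else i)" for i
  have "bij_betw ((!) xs) {..<n} {1..n}"
    using xs by (intro bij_betw_nth) auto
  moreover have "bij_betw (\<lambda>i. i - 1) {1..n} {..<n}"
    by (rule bij_betw_byWitness[where f' = Suc]) auto
  ultimately have "bij_betw ((!) xs \<circ> (\<lambda>i. i - 1)) {1..n} {1..n}"
    by (rule bij_betw_trans[rotated])
  then have "bij_betw \<pi> {1..n} {1..n}"
    by (rule bij_betw_cong[THEN iffD1, rotated]) (simp add: \<pi>_def)
  then have "\<pi> permutes {1..n}" by (rule bij_imp_permutes) (auto simp: \<pi>_def)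
  moreover have "i < j" if ij: "i \<in> {1..n}" "j \<in> {1..n}" "poset_less P (\<pi> i) (\<pi> j)" for i j
  proof (rule ccontr)
    assume "\<not> i < j"
    then have "h (\<pi> j) \<le> h (\<pi> i)"
      using ij xs sorted_nth_mono[OF xs(4), of "j - 1" "i - 1"] by (auto simp: \<pi>_def)
    with h[OF ij(3)] show False by simp
  qed
  ultimately have "\<pi> \<in> linear_extensions n P" by (auto simp: linear_extensions_def)
  then show ?thesis by blast
qed

lemma nontrivial_poset_ge_2: "nontrivial_poset n P \<Longrightarrow> 2 \<le> n"
  by (cases "n = 0 \<or> n = 1") (auto simp: nontrivial_poset_def total_on_def)

lemma symmetric_gap_r2r_matrix:
  assumes P: "nontrivial_poset n P"
    and ev: "\<And>c. eigenvalue (r2r_matrix n P) c \<Longrightarrow> 0 \<le> c"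
    and second: "second_largest_eigenvalue (r2r_matrix n P) \<le> q" and q: "0 \<le> q" "q < 1"
  shows "symmetric_gap (r2r_matrix n P) (card (linear_extensions n P)) q"
proof
  let ?L = "linear_extensions n P"
  have entry: "r2r_matrix n P $$ (a, b) = r2r_prob n P (from_nat_into ?L a) (from_nat_into ?L b)"
    if "a < card ?L" "b < card ?L" for a b
    using that by (simp add: r2r_matrix_def Let_def)
  show "r2r_matrix n P \<in> carrier_mat (card ?L) (card ?L)"
    by (simp add: r2r_matrix_def Let_def)
  have ne: "?L \<noteq> {}"
    using P by (intro linear_extensions_nonempty) (simp add: nontrivial_poset_def)
  then show "0 < card ?L" using finite_linear_extensions by (simp add: card_gt_0_iff)
  show "r2r_matrix n P $$ (a, b) = r2r_matrix n P $$ (b, a)"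
    if "a < card ?L" "b < card ?L" for a b
    using that by (simp add: entry r2r_prob_symmetric)
  show "(\<Sum>b<card ?L. r2r_matrix n P $$ (a, b)) = 1" if a: "a < card ?L" for a
  proof -
    have "(\<Sum>b<card ?L. r2r_matrix n P $$ (a, b))
        = (\<Sum>b<card ?L. r2r_prob n P (from_nat_into ?L a) (from_nat_into ?L b))"
      using a by (simp add: entry)
    also have "\<dots> = (\<Sum>\<pi>'\<in>?L. r2r_prob n P (from_nat_into ?L a) \<pi>')"
      by (rule sum.reindex_bij_betw[OF bij_betw_from_nat_into_finite[OF finite_linear_extensions]])
    also have "\<dots> = 1"
      using nontrivial_poset_ge_2[OF P] from_nat_into[OF ne] by (intro sum_r2r_prob) auto
    finally show ?thesis .
  qed
qed (use assms in auto)

lemma mixing_time_le: "mixing_dist A t \<le> \<epsilon> \<Longrightarrow> mixing_time A \<epsilon> \<le> enat t"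
  unfolding mixing_time_def by (rule Inf_lower) auto

section \<open>The mixing time bound\<close>

text \<open>
  The hypothesis on \<open>t\<close> is what \<open>n\<^sup>2\<^sup>n exp (- t/n) \<le> \<epsilon>\<close> becomes on taking logarithms.
\<close>

lemma r2r_mixing_time_le:
  assumes P: "nontrivial_poset n P" and "0 < \<epsilon>"
    and ev: "\<And>c. eigenvalue (r2r_matrix n P) c \<Longrightarrow> 0 \<le> c"
    and second: "second_largest_eigenvalue (r2r_matrix n P) \<le> 1 - 1 / real n"
    and t: "real n * (2 * real n * ln (real n) - ln \<epsilon>) \<le> real t"
  shows "mixing_time (r2r_matrix n P) \<epsilon> \<le> enat t"
proof (rule mixing_time_le)
  let ?N = "card (linear_extensions n P)"
  have n: "2 \<le> n" by (rule nontrivial_poset_ge_2[OF P])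
  interpret symmetric_gap "r2r_matrix n P" ?N "1 - 1 / real n"
    using n by (intro symmetric_gap_r2r_matrix[OF P ev second]) (auto simp: field_simps)
  have "(1 - 1 / real n) ^ t \<le> exp (- 1 / real n) ^ t"
    using n exp_ge_add_one_self[of "- 1 / real n"] by (intro power_mono) (auto simp: field_simps)
  also have "\<dots> = exp (- (real t / real n))" by (simp flip: exp_of_nat_mult)
  finally have pow: "(1 - 1 / real n) ^ t \<le> exp (- (real t / real n))" .
  have "(real ?N)\<^sup>2 \<le> (real n ^ n)\<^sup>2"
    using card_linear_extensions_le[of n P] by (intro power_mono) (simp_all flip: of_nat_power)
  also have "\<dots> = exp (2 * real n * ln (real n))"
  proof -
    have "exp (real n * ln (real n)) = real n ^ n" using n by (simp add: exp_of_nat_mult)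
    then show ?thesis by (simp add: mult.assoc exp_double)
  qed
  finally have N: "(real ?N)\<^sup>2 \<le> exp (2 * real n * ln (real n))" .
  have "mixing_dist (r2r_matrix n P) t \<le> (real ?N)\<^sup>2 * (1 - 1 / real n) ^ t"
    by (rule mixing_dist_le)
  also have "\<dots> \<le> exp (2 * real n * ln (real n)) * exp (- (real t / real n))"
    using N pow q_nonneg by (intro mult_mono) auto
  also have "\<dots> = exp (2 * real n * ln (real n) - real t / real n)"
    by (simp flip: exp_add)
  also have "\<dots> \<le> exp (ln \<epsilon>)"
    using t n by (simp add: field_simps)
  finally show "mixing_dist (r2r_matrix n P) t \<le> \<epsilon>" using \<open>0 < \<epsilon>\<close> by simp
qed

text \<open>
  The number of steps is rounded up to an integer, and the terms \<open>n \<bar>ln \<epsilon>\<bar>\<close> and \<open>1\<close>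
  (from rounding) are absorbed into \<open>n\<^sup>2 ln n\<close>. This is possible with a constant uniform in
  \<open>n\<close> because a nontrivial poset has at least two elements, so that \<open>ln n \<ge> ln 2 > 0\<close>.
\<close>

theorem theorem2p1:
  assumes "\<forall>m Q. nontrivial_poset m Q \<longrightarrow>
      second_largest_eigenvalue (r2r_matrix m Q) \<le> (1 + 1 / real m) * (1 - 2 / real m) \<and>
      (second_largest_eigenvalue (r2r_matrix m Q) = (1 + 1 / real m) * (1 - 2 / real m)
         \<longleftrightarrow> disconnected_poset m Q) \<and>
      (\<forall>x. eigenvalue (r2r_matrix m Q) x \<longrightarrow> 0 \<le> x)"
  shows "\<forall>\<epsilon>>0. \<exists>C. \<forall>n P. nontrivial_poset n P \<longrightarrow>
      ereal_of_enat (mixing_time (r2r_matrix n P) \<epsilon>) \<le> ereal (C * (real n)\<^sup>2 * ln (real n))"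
proof (intro allI impI)
  fix \<epsilon> :: real
  assume "0 < \<epsilon>"
  define K where "K = \<bar>ln \<epsilon>\<bar> + 1"
  have "ereal_of_enat (mixing_time (r2r_matrix n P) \<epsilon>)
      \<le> ereal ((2 + K / ln 2) * (real n)\<^sup>2 * ln (real n))" if P: "nontrivial_poset n P" for n P
  proof -
    have n: "2 \<le> n" by (rule nontrivial_poset_ge_2[OF P])
    have "(1 + 1 / real n) * (1 - 2 / real n) \<le> 1 - 1 / real n"
      using n by (simp add: field_simps)
    then have second: "second_largest_eigenvalue (r2r_matrix n P) \<le> 1 - 1 / real n"
      using assms P by (meson order.trans)
    define r where "r = real n * (2 * real n * ln (real n) + \<bar>ln \<epsilon>\<bar>)"
    define t where "t = nat \<lceil>r\<rceil>"
    have "0 \<le> r" using n by (simp add: r_def)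
    then have t: "r \<le> real t" "real t \<le> r + 1" by (simp_all add: t_def)
    have "real n * (2 * real n * ln (real n) - ln \<epsilon>) \<le> r"
      unfolding r_def by (intro mult_left_mono) auto
    then have "mixing_time (r2r_matrix n P) \<epsilon> \<le> enat t"
      using assms P second t(1) \<open>0 < \<epsilon>\<close> by (intro r2r_mixing_time_le) auto
    then have "ereal_of_enat (mixing_time (r2r_matrix n P) \<epsilon>) \<le> ereal (real t)"
      by (metis ereal_of_enat_le_iff ereal_of_enat_simps(1))
    also have "real t \<le> 2 * (real n)\<^sup>2 * ln (real n) + (real n * \<bar>ln \<epsilon>\<bar> + 1)"
      using t(2) by (simp add: r_def power2_eq_square algebra_simps)
    also have "real n * \<bar>ln \<epsilon>\<bar> + 1 \<le> (real n)\<^sup>2 * K"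
    proof -
      have "real n \<le> (real n)\<^sup>2" "1 \<le> (real n)\<^sup>2" using n by (auto intro: self_le_power)
      then have "real n * \<bar>ln \<epsilon>\<bar> \<le> (real n)\<^sup>2 * \<bar>ln \<epsilon>\<bar>" by (intro mult_right_mono) auto
      with \<open>1 \<le> (real n)\<^sup>2\<close> show ?thesis by (simp add: K_def distrib_left)
    qed
    also have "(real n)\<^sup>2 * K \<le> (real n)\<^sup>2 * (K * (ln (real n) / ln 2))"
    proof -
      have "1 \<le> ln (real n) / ln 2" using n by simp
      then have "K * 1 \<le> K * (ln (real n) / ln 2)" by (intro mult_left_mono) (auto simp: K_def)
      then show ?thesis by (intro mult_left_mono) auto
    qed
    finally show ?thesis by (simp add: algebra_simps)
  qed
  then show "\<exists>C. \<forall>n P. nontrivial_poset n P \<longrightarrow>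
      ereal_of_enat (mixing_time (r2r_matrix n P) \<epsilon>) \<le> ereal (C * (real n)\<^sup>2 * ln (real n))"
    by blast
qed

end
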